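(* Let $D=(A,B,\lambda)$ be a temporal bi-clique with $A,B$ nonempty and $\lambda$ injective. Then $D$ is extremally matched or $D$ has a dismountable vertex.
   Context: A temporal bi-clique $(A,B,\lambda)$ is the complete bipartite graph with disjoint parts $A,B$ with an edge labeling $\lambda$ into $\mathbb{N}$. For a vertex $v$, $\pi^-(v)$ is the neighbor $u$ of $v$ minimizing $\lambda(\{v,u\})$ and $\pi^+(v)$ the neighbor maximizing it. $D$ is extremally matched if both $\{\{v,\pi^-(v)\}: v\in A\cup B\}$ and $\{\{v,\pi^+(v)\}: v\in A\cup B\}$ are perfect matchings of the complete bipartite graph on $A\sqcup B$. A vertex $a\in A$ is dismountable if there is $a'\in A$, $a'\ne a$, with $\lambda(\{a,\pi^-(a')\})\le\lambda(\{a',\pi^-(a')\})$. A vertex $b\in B$ is dismountable if there is $b'\in B$, $b'\ne b$, with $\lambda(\{b',\pi^+(b')\})\le\lambda(\{b,\pi^+(b')\})$. *)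

theory Defs
  imports Main
begin

definition biclique_edges :: "'a set \<Rightarrow> 'a set \<Rightarrow> 'a set set" where
  "biclique_edges A B = {{a, b} | a b. a \<in> A \<and> b \<in> B}"

text \<open>Graphs are finite. The labeling is a total function on vertex sets; only its
  values on \<^term>\<open>biclique_edges A B\<close> are ever used.\<close>

definition temporal_biclique :: "'a set \<Rightarrow> 'a set \<Rightarrow> ('a set \<Rightarrow> nat) \<Rightarrow> bool" where
  "temporal_biclique A B lam \<longleftrightarrow> finite A \<and> finite B \<and> A \<inter> B = {}"

definition neighbors :: "'a set \<Rightarrow> 'a set \<Rightarrow> 'a \<Rightarrow> 'a set" where
  "neighbors A B v = {u. {v, u} \<in> biclique_edges A B}"

definition pi_minus :: "'a set \<Rightarrow> 'a set \<Rightarrow> ('a set \<Rightarrow> nat) \<Rightarrow> 'a \<Rightarrow> 'a" where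
  "pi_minus A B lam v = arg_min_on (\<lambda>u. lam {v, u}) (neighbors A B v)"

definition pi_plus :: "'a set \<Rightarrow> 'a set \<Rightarrow> ('a set \<Rightarrow> nat) \<Rightarrow> 'a \<Rightarrow> 'a" where
  "pi_plus A B lam v = arg_max_on (\<lambda>u. lam {v, u}) (neighbors A B v)"

definition perfect_matching :: "'a set \<Rightarrow> 'a set \<Rightarrow> 'a set set \<Rightarrow> bool" where
  "perfect_matching A B M \<longleftrightarrow>
     M \<subseteq> biclique_edges A B \<and> (\<forall>v \<in> A \<union> B. \<exists>!e. e \<in> M \<and> v \<in> e)"

definition extremally_matched :: "'a set \<Rightarrow> 'a set \<Rightarrow> ('a set \<Rightarrow> nat) \<Rightarrow> bool" where
  "extremally_matched A B lam \<longleftrightarrow>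
     perfect_matching A B {{v, pi_minus A B lam v} | v. v \<in> A \<union> B} \<and>
     perfect_matching A B {{v, pi_plus A B lam v} | v. v \<in> A \<union> B}"

definition dismountable :: "'a set \<Rightarrow> 'a set \<Rightarrow> ('a set \<Rightarrow> nat) \<Rightarrow> 'a \<Rightarrow> bool" where
  "dismountable A B lam v \<longleftrightarrow>
     (v \<in> A \<and> (\<exists>a' \<in> A. a' \<noteq> v \<and>
        lam {v, pi_minus A B lam a'} \<le> lam {a', pi_minus A B lam a'})) \<or>
     (v \<in> B \<and> (\<exists>b' \<in> B. b' \<noteq> v \<and>
        lam {b', pi_plus A B lam b'} \<le> lam {v, pi_plus A B lam b'}))"

end

theory Submission
  imports Defs
begin

text \<open>If no vertex of \<open>A\<close> is dismountable, then every \<open>a \<in> A\<close> is the strict minimizer seen from its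
  earliest neighbor, so \<open>\<pi>\<^sup>-(\<pi>\<^sup>-(a)) = a\<close> and \<open>\<pi>\<^sup>-\<close> injects \<open>A\<close> into \<open>B\<close>. Dually, if no vertex of
  \<open>B\<close> is dismountable, then \<open>\<pi>\<^sup>+\<close> injects \<open>B\<close> into \<open>A\<close>. By finiteness both injections are
  surjective, and a map that is its own inverse and exchanges the parts is a perfect matching.\<close>

lemma arg_min_on_eqI:
  fixes f :: "'a \<Rightarrow> 'b::order"
  assumes "x \<in> S" and "\<And>y. y \<in> S \<Longrightarrow> y \<noteq> x \<Longrightarrow> f x < f y"
  shows "arg_min_on f S = x"
  unfolding arg_min_on_def by (rule arg_minI) (use assms in \<open>force+\<close>)

lemma arg_max_on_eqI:
  fixes f :: "'a \<Rightarrow> 'b::order"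
  assumes "x \<in> S" and "\<And>y. y \<in> S \<Longrightarrow> y \<noteq> x \<Longrightarrow> f y < f x"
  shows "arg_max_on f S = x"
  unfolding arg_max_on_def by (rule arg_maxI) (use assms in \<open>force+\<close>)

lemma arg_max_on_in:
  fixes f :: "'a \<Rightarrow> 'b::order"
  assumes "finite S" and "S \<noteq> {}"
  shows "arg_max_on f S \<in> S"
proof -
  obtain x where "x \<in> S" and "\<And>y. y \<in> S \<Longrightarrow> \<not> f x < f y"
    using finite_has_maximal[of "f ` S"] assms by (auto simp: less_le)
  then show ?thesis
    unfolding arg_max_on_def by (rule arg_maxI)
qed

lemma image_eq_if_mutual_injections:
  assumes "finite A" and "finite B"
    and "inj_on f A" and "f ` A \<subseteq> B" and "inj_on g B" and "g ` B \<subseteq> A"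
  shows "f ` A = B"
proof (rule card_subset_eq)
  have "card A = card B"
    using assms by (intro card_bij_eq)
  then show "card (f ` A) = card B"
    using \<open>inj_on f A\<close> by (simp add: card_image)
qed (use assms in auto)

lemma biclique_edges_commute: "biclique_edges A B = biclique_edges B A"
  unfolding biclique_edges_def by (auto simp: insert_commute)

lemma perfect_matching_commute: "perfect_matching A B M \<longleftrightarrow> perfect_matching B A M"
  unfolding perfect_matching_def by (simp add: biclique_edges_commute Un_commute)

lemma neighbors_commute: "neighbors A B = neighbors B A"
  by (intro ext) (simp add: neighbors_def biclique_edges_commute)

lemma neighbors_left:
  assumes "A \<inter> B = {}" and "a \<in> A"
  shows "neighbors A B a = B"
  using assms unfolding neighbors_def biclique_edges_def by (auto simp: doubleton_eq_iff)

lemma neighbors_right: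
  assumes "A \<inter> B = {}" and "b \<in> B"
  shows "neighbors A B b = A"
  using assms by (simp add: neighbors_commute[of A B] neighbors_left Int_commute)

lemma perfect_matching_self_inverse:
  assumes image: "g ` A = B" and left_inverse: "\<And>a. a \<in> A \<Longrightarrow> g (g a) = a"
  shows "perfect_matching A B {{v, g v} | v. v \<in> A \<union> B}"
proof -
  have self_inverse: "g (g v) = v" if "v \<in> A \<union> B" for v
    using that image left_inverse by force
  have "{v, g v} \<in> biclique_edges A B" if "v \<in> A \<union> B" for v
  proof -
    have "(v \<in> A \<and> g v \<in> B) \<or> (g v \<in> A \<and> v \<in> B)"
      using that image left_inverse by force
    then show ?thesis
      unfolding biclique_edges_def by blast
  qed
  moreover have "\<exists>!e. e \<in> {{v, g v} | v. v \<in> A \<union> B} \<and> v \<in> e" if "v \<in> A \<union> B" for v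
  proof (rule ex1I)
    show "{v, g v} \<in> {{v, g v} | v. v \<in> A \<union> B} \<and> v \<in> {v, g v}"
      using that by blast
    show "e = {v, g v}" if "e \<in> {{v, g v} | v. v \<in> A \<union> B} \<and> v \<in> e" for e
      using that self_inverse by (auto simp: insert_commute)
  qed
  ultimately show ?thesis
    unfolding perfect_matching_def by blast
qed

lemma pi_minus_in_right:
  assumes "A \<inter> B = {}" and "B \<noteq> {}" and "a \<in> A"
  shows "pi_minus A B lam a \<in> B"
  using assms by (auto simp: pi_minus_def neighbors_left arg_min_on_def intro: arg_min_natI)

lemma pi_plus_in_left:
  assumes "A \<inter> B = {}" and "finite A" and "A \<noteq> {}" and "b \<in> B"
  shows "pi_plus A B lam b \<in> A"
  using assms by (simp add: pi_plus_def neighbors_right arg_max_on_in)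

lemma pi_minus_pi_minus:
  assumes "A \<inter> B = {}" and "B \<noteq> {}" and a: "a \<in> A"
    and not_dismountable: "\<And>v. v \<in> A \<Longrightarrow> \<not> dismountable A B lam v"
  shows "pi_minus A B lam (pi_minus A B lam a) = a"
proof -
  let ?b = "pi_minus A B lam a"
  have "lam {?b, a} < lam {?b, v}" if "v \<in> A" "v \<noteq> a" for v
    using not_dismountable[of v] a that
    by (auto simp: dismountable_def not_le insert_commute)
  then have "arg_min_on (\<lambda>u. lam {?b, u}) A = a"
    using a by (intro arg_min_on_eqI)
  moreover have "neighbors A B ?b = A"
    using assms by (intro neighbors_right pi_minus_in_right)
  ultimately show ?thesis
    by (simp add: pi_minus_def[of A B lam ?b])
qed

lemma pi_plus_pi_plus:
  assumes "A \<inter> B = {}" and "finite A" and "A \<noteq> {}" and b: "b \<in> B"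
    and not_dismountable: "\<And>v. v \<in> B \<Longrightarrow> \<not> dismountable A B lam v"
  shows "pi_plus A B lam (pi_plus A B lam b) = b"
proof -
  let ?a = "pi_plus A B lam b"
  have "lam {?a, v} < lam {?a, b}" if "v \<in> B" "v \<noteq> b" for v
    using not_dismountable[of v] b that
    by (auto simp: dismountable_def not_le insert_commute)
  then have "arg_max_on (\<lambda>u. lam {?a, u}) B = b"
    using b by (intro arg_max_on_eqI)
  moreover have "neighbors A B ?a = B"
    using assms by (intro neighbors_left pi_plus_in_left)
  ultimately show ?thesis
    by (simp add: pi_plus_def[of A B lam ?a])
qed

theorem theorem16:
  fixes A B :: "'a set" and lam :: "'a set \<Rightarrow> nat"
  assumes "temporal_biclique A B lam"
    and "A \<noteq> {}" and "B \<noteq> {}"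
    and "inj_on lam (biclique_edges A B)"
  shows "extremally_matched A B lam \<or> (\<exists>v \<in> A \<union> B. dismountable A B lam v)"
proof (rule disjCI)
  assume not_dismountable: "\<not> (\<exists>v \<in> A \<union> B. dismountable A B lam v)"
  let ?m = "pi_minus A B lam" and ?p = "pi_plus A B lam"
  have finite_parts: "finite A" "finite B" and disjoint: "A \<inter> B = {}"
    using assms(1) by (auto simp: temporal_biclique_def)
  have minus_self_inverse: "?m (?m a) = a" if "a \<in> A" for a
    using that not_dismountable disjoint assms(3) by (intro pi_minus_pi_minus) auto
  have plus_self_inverse: "?p (?p b) = b" if "b \<in> B" for b
    using that not_dismountable disjoint finite_parts assms(2) by (intro pi_plus_pi_plus) auto
  have maps_into: "?m ` A \<subseteq> B" "?p ` B \<subseteq> A"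
    using disjoint finite_parts assms(2,3) by (auto intro: pi_minus_in_right pi_plus_in_left)
  have injective: "inj_on ?m A" "inj_on ?p B"
    using inj_on_inverseI[of A ?m ?m] inj_on_inverseI[of B ?p ?p]
      minus_self_inverse plus_self_inverse by simp_all
  have "?m ` A = B" and "?p ` B = A"
    using image_eq_if_mutual_injections[of A B ?m ?p]
      image_eq_if_mutual_injections[of B A ?p ?m] finite_parts maps_into injective by simp_all
  then have "perfect_matching A B {{v, ?m v} | v. v \<in> A \<union> B}"
    and "perfect_matching B A {{v, ?p v} | v. v \<in> B \<union> A}"
    using perfect_matching_self_inverse[of ?m A B] perfect_matching_self_inverse[of ?p B A]
      minus_self_inverse plus_self_inverse by simp_all
  then show "extremally_matched A B lam"
    by (simp add: extremally_matched_def perfect_matching_commute[of B A] Un_commute)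
qed

end
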